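(* For every formula $xPy$ of the $(\{\mathbf{1},\cup,\cap\};\_)$-fragment of $\mathsf{RL}(\mathbf{1})$, the dual tableau procedure (described in the context), started on the initial deduction tree for $xPy$, always terminates.
   Context: **Syntax and semantics.** Let $\mathbb{RV}$ be a countably infinite set of relational variables $\mathsf{r},\mathsf{s},\dots$, $\mathbf{1}$ a relational constant, $\mathbb{OV}$ a countably infinite set of object variables. A formula is an expression $xRy$ with $x,y\in\mathbb{OV}$ and $R$ a relational term. Only terms built with $-$ (complement), $\cup$, $\cap$, $;$ (composition) are needed here. A Boolean term is one involving only $-,\cup,\cap$. A literal is a formula $x\mathsf{r}y$, $x\mathbf{1}y$, $x(-\mathsf{r})y$ or $x(-\mathbf{1})y$. **The fragment.** The $(\{\mathbf{1},\cup,\cap\};\_)$-fragment consists of the formulae $xPy$ with $P\in\mathbb{RT}_0$, where $\mathbb{RT}_0$ is the smallest set of terms containing $\mathbf{1}$ and all relational variables such that: if $P,Q,B,H\in\mathbb{RT}_0$ and $S\in\{H,\mathbf{1}\}$, with $B$ a Boolean term containing neither $\mathbf{1}$ nor $-$, and $H$ containing $\mathbf{1}$ only inside terms of the form $(B';\mathbf{1})$ ($B'$ Boolean without $\mathbf{1}$ and $-$), then $(-P),(P\cup Q),(P\cap Q),(B;S),(\mathbf{1};S)\in\mathbb{RT}_0$. Below, $B$, $B_1$ always denote Boolean terms without $\mathbf{1}$ and $-$. **Bool-constructions.** The complement normal form $\mathsf{nf}_-(R)$ of a Boolean term $R$ is obtained by pushing complements inside by the De Morgan laws and double negation: it fixes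 $\mathbf{1}$, $-\mathbf{1}$, $\mathsf{s}$, $-\mathsf{s}$, commutes with $\cup$ and $\cap$, and $\mathsf{nf}_-(-(S\cap H))=\mathsf{nf}_-(-S)\cup\mathsf{nf}_-(-H)$, $\mathsf{nf}_-(-(S\cup H))=\mathsf{nf}_-(-S)\cap\mathsf{nf}_-(-H)$, $\mathsf{nf}_-(--S)=\mathsf{nf}_-(S)$. For a set $N$ of formulae, the $\mathsf{Bool}_N$-formulae are defined by: every literal in $N$ is a $\mathsf{Bool}_N$-formula; $x(R\cap S)y$ is a $\mathsf{Bool}_N$-formula if one of $xRy$, $xSy$ is a $\mathsf{Bool}_N$-formula and the term of the other is in complement normal form; $x(R\cup S)y$ is a $\mathsf{Bool}_N$-formula if both $xRy$ and $xSy$ are. The formula $xRy$ has a Bool-construction from $N$ if $x\,\mathsf{nf}_-(R)\,y$ is a $\mathsf{Bool}_N$-formula. $V(R,x,N)$ is the set of object variables $z$ such that $xRz$ has a Bool-construction from $N$. **Deduction trees.** Nodes are labelled by (disjunctive) finite sets of formulae. A set is axiomatic if it contains some $uRw$ together with $u(-R)w$, or some $u\mathbf{1}w$. For a branch $\theta$, $\bigcup\theta$ is the set of all formulae in its nodes and $W_\theta$ the set of object variables occurring in them. A branch is axiomatic (closed) if one of its nodes is. The initial deduction tree for $xPy$ is the single node $\{xPy\}$. A deduction tree is extended at a non-axiomatic leaf $N$ of a branch $\theta$ by choosing $\varphi\in N$ and a rule for $\varphi$, and appending for each conclusion set $\Gamma$ (several sets are separated by $|$, giving branching) the node $(N\setminus\{\varphi\})\cup\Gamma$.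 The rules are: - Boolean rules: $u(R\cup S)w\leadsto uRw,uSw$; $u(-(R\cup S))w\leadsto u(-R)w\,|\,u(-S)w$; $u(R\cap S)w\leadsto uRw\,|\,uSw$; $u(-(R\cap S))w\leadsto u(-R)w,u(-S)w$; $u(--R)w\leadsto uRw$. - $(-;)$-rules, with $z$ a new object variable: $u(-(B;S))y\leadsto u(-B)z,\ z(-S)y$ if $S\ne\mathbf{1}$; $u(-(B;\mathbf{1}))y\leadsto u(-B)z$; $x(-(\mathbf{1};S))y\leadsto z(-S)y$ if $S\neq\mathbf{1}$, applied only if the branch contains no formula $z'(-S)y$ with $z'$ a new variable (i.e. introduced by a rule). The formula $x(-(\mathbf{1};\mathbf{1}))y$ is not decomposed. - $(;)_a$: $u(B;S)y\leadsto zSy,\ u(B;S)y$ with $z\in V(-B,u,\bigcup\theta)$. - $(;)_b$: $x(\mathbf{1};S)y\leadsto zSy,\ x(\mathbf{1};S)y$ with $z$ any variable already occurring, provided $zSy$ is not already in the branch. **Order on variables.** A variable $z\in W_\theta\setminus\{x,y\}$ is a descendant (of degree 1) of $w$ if $z$ was introduced by decomposing a formula $w(-(B;S))y$; descendants of higher degree are obtained by iterating. $<_\theta$ is a total order on $W_\theta$ such that $x$ is least; variables in $W_\theta\setminus\{x,y\}$ are ordered by time of introduction; $y<_\theta z$ for every descendant $z$ of $y$; and $w<_\theta y$ for every $w\ne y$ that is not a descendant of $y$. **Blocking.** In a branch $\theta$, $z'(-(B;S))y$ blocks $z(-(B;S))y$ (same $B,S,y$, different left variable) if $z'(-(B;S))y$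 has already been decomposed in $\theta$, using the new variable $w$, and for every formula $z(B_1;Q)y$ occurring in $\theta$ such that $z(-B_1)w$ has a Bool-construction from the set of literals that result from the Boolean decomposition of $z(-B)w$ (i.e. the literals $z(-\mathsf{r})w$ corresponding to the literals $z'(-\mathsf{r})w$ obtained in $\theta$ from $z'(-B)w$), the formula $z'(B_1;Q)y$ occurs in $\theta$ as well. **Procedure.** Start from the initial deduction tree for $xPy$. 1. Consider each non-axiomatic branch $\theta$ of the current deduction tree. 2. While $\theta$ is non-axiomatic and further expandable (some rule application permitted below is still possible), let $z$ be the $<_\theta$-smallest variable for which some permitted decomposition is still outstanding (a formula with left variable $z$ not yet decomposed, or a formula $x(\mathbf{1};S)y$ not yet decomposed with $z$). Apply to the formulae with left variable $z$ the rules in this order: Boolean rules, $(-;)$-rules, $(;)_a$; then apply $(;)_b$ to the formulae $x(\mathbf{1};S)y$ in $\theta$ with the variable $z$, until saturation. Requirements: (a) each rule is applied at most once with the same premise (for $(;)_a$ and $(;)_b$: the same premise and the same variable $z$); (b) a formula $z(-(B;S))y$ is not decomposed if it is blocked by some $z'(-(B;S))y$ occurring in $\theta$. 3. If $\theta$ is axiomatic and all other branches are axiomatic, stop: the current tree is a (closed) proof tree for $xPy$. If $\theta$ is axiomatic and there are still non-axiomatic branches, return to step 1. 4. Otherwise $\theta$ is a non-axiomatic, not further expandable branch: stop and return $\theta$ (together with a model and a valuation directly read off from $\theta$). *)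

theory Defs
  imports Main
begin

type_synonym rvar = nat
type_synonym ovar = nat

datatype rterm =
    RVar rvar
  | One
  | Neg rterm
  | Cup rterm rterm
  | Cap rterm rterm
  | Comp rterm rterm

datatype fm = Fm (lvar: ovar) (trm: rterm) (rvar: ovar)

fun is_literal :: "fm \<Rightarrow> bool" where
  "is_literal (Fm u (RVar r) w) = True"
| "is_literal (Fm u One w) = True"
| "is_literal (Fm u (Neg (RVar r)) w) = True"
| "is_literal (Fm u (Neg One) w) = True"
| "is_literal _ = False"

primrec boolean :: "rterm \<Rightarrow> bool" where
  "boolean (RVar r) = True"
| "boolean One = True"
| "boolean (Neg R) = boolean R"
| "boolean (Cup R S) = (boolean R \<and> boolean S)"
| "boolean (Cap R S) = (boolean R \<and> boolean S)"
| "boolean (Comp R S) = False"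

text \<open>Boolean terms containing neither the constant \<open>One\<close> nor complement
  (the terms written \<open>B\<close>).\<close>

primrec pos_boolean :: "rterm \<Rightarrow> bool" where
  "pos_boolean (RVar r) = True"
| "pos_boolean One = False"
| "pos_boolean (Neg R) = False"
| "pos_boolean (Cup R S) = (pos_boolean R \<and> pos_boolean S)"
| "pos_boolean (Cap R S) = (pos_boolean R \<and> pos_boolean S)"
| "pos_boolean (Comp R S) = False"

text \<open>Every occurrence of \<open>One\<close> lies inside a subterm \<open>Comp B One\<close>
  with \<open>pos_boolean B\<close>.\<close>

primrec one_guarded :: "rterm \<Rightarrow> bool" where
  "one_guarded (RVar r) = True"
| "one_guarded One = False"
| "one_guarded (Neg R) = one_guarded R"
| "one_guarded (Cup R S) = (one_guarded R \<and> one_guarded S)"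
| "one_guarded (Cap R S) = (one_guarded R \<and> one_guarded S)"
| "one_guarded (Comp R S) =
     ((pos_boolean R \<and> S = One) \<or> (one_guarded R \<and> one_guarded S))"

inductive_set RT0 :: "rterm set" where
  RT0_One: "One \<in> RT0"
| RT0_RVar: "RVar r \<in> RT0"
| RT0_Neg: "P \<in> RT0 \<Longrightarrow> Neg P \<in> RT0"
| RT0_Cup: "P \<in> RT0 \<Longrightarrow> Q \<in> RT0 \<Longrightarrow> Cup P Q \<in> RT0"
| RT0_Cap: "P \<in> RT0 \<Longrightarrow> Q \<in> RT0 \<Longrightarrow> Cap P Q \<in> RT0"
| RT0_Comp: "B \<in> RT0 \<Longrightarrow> pos_boolean B \<Longrightarrow> H \<in> RT0 \<Longrightarrow> one_guarded H \<Longrightarrow>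
    S \<in> {H, One} \<Longrightarrow> Comp B S \<in> RT0"
| RT0_One_Comp: "H \<in> RT0 \<Longrightarrow> one_guarded H \<Longrightarrow> S \<in> {H, One} \<Longrightarrow> Comp One S \<in> RT0"


text \<open>The last equation also covers the terms \<open>Comp R S\<close> and \<open>Neg (Comp R S)\<close>,
  which are not Boolean and for which the normal form is irrelevant.\<close>

fun cnf :: "rterm \<Rightarrow> rterm" where
  "cnf (Neg (Neg R)) = cnf R"
| "cnf (Neg (Cup R S)) = Cap (cnf (Neg R)) (cnf (Neg S))"
| "cnf (Neg (Cap R S)) = Cup (cnf (Neg R)) (cnf (Neg S))"
| "cnf (Cup R S) = Cup (cnf R) (cnf S)"
| "cnf (Cap R S) = Cap (cnf R) (cnf S)"
| "cnf R = R"

definition in_cnf :: "rterm \<Rightarrow> bool" where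
  "in_cnf R \<longleftrightarrow> boolean R \<and> cnf R = R"

inductive_set Bool_fms :: "fm set \<Rightarrow> fm set" for N :: "fm set" where
  Bool_lit: "\<phi> \<in> N \<Longrightarrow> is_literal \<phi> \<Longrightarrow> \<phi> \<in> Bool_fms N"
| Bool_Cap1: "Fm u R w \<in> Bool_fms N \<Longrightarrow> in_cnf S \<Longrightarrow> Fm u (Cap R S) w \<in> Bool_fms N"
| Bool_Cap2: "Fm u S w \<in> Bool_fms N \<Longrightarrow> in_cnf R \<Longrightarrow> Fm u (Cap R S) w \<in> Bool_fms N"
| Bool_Cup: "Fm u R w \<in> Bool_fms N \<Longrightarrow> Fm u S w \<in> Bool_fms N \<Longrightarrow>
    Fm u (Cup R S) w \<in> Bool_fms N"

fun has_Bool_construction :: "fm \<Rightarrow> fm set \<Rightarrow> bool" where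
  "has_Bool_construction (Fm u R w) N \<longleftrightarrow> Fm u (cnf R) w \<in> Bool_fms N"

definition V :: "rterm \<Rightarrow> ovar \<Rightarrow> fm set \<Rightarrow> ovar set" where
  "V R u N = {z. has_Bool_construction (Fm u R z) N}"


text \<open>A rule instance records its premise together with, for \<open>NegCompI\<close>, the new
  variable it introduces and, for \<open>CompAI\<close> and \<open>CompBI\<close>, the variable it is applied with.\<close>

datatype inst =
    BoolI (prem: fm)
  | NegCompI (prem: fm) ovar
  | CompAI (prem: fm) ovar
  | CompBI (prem: fm) ovar

text \<open>An inner node carries its label and the rule instance applied there; its
  subtrees correspond to the conclusion sets of that instance.\<close>

datatype dtree = Leaf "fm set" | Inner "fm set" inst "dtree list"

text \<open>A branch lists its inner nodes, root first, followed by its leaf.\<close>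

datatype branch = Branch (hist: "(fm set \<times> inst) list") (leaf: "fm set")

text \<open>\<open>branch_at t p \<theta>\<close>: the path \<open>p\<close> of child indices leads from the root of \<open>t\<close> to a
  leaf, and \<open>\<theta>\<close> is the branch ending there. Paths are needed because two different
  branches may carry the same labels.\<close>

inductive branch_at :: "dtree \<Rightarrow> nat list \<Rightarrow> branch \<Rightarrow> bool" where
  "branch_at (Leaf N) [] (Branch [] N)"
| "k < length ts \<Longrightarrow> branch_at (ts ! k) p (Branch h L) \<Longrightarrow>
    branch_at (Inner N i ts) (k # p) (Branch ((N, i) # h) L)"

fun extend :: "dtree \<Rightarrow> nat list \<Rightarrow> inst \<Rightarrow> fm set list \<Rightarrow> dtree" where
  "extend (Leaf N) [] i \<Gamma>s = Inner N i (map (\<lambda>\<Gamma>. Leaf ((N - {prem i}) \<union> \<Gamma>)) \<Gamma>s)"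
| "extend (Inner N j ts) (k # p) i \<Gamma>s = Inner N j (ts[k := extend (ts ! k) p i \<Gamma>s])"
| "extend t p i \<Gamma>s = t"

definition axiomatic :: "fm set \<Rightarrow> bool" where
  "axiomatic N \<longleftrightarrow>
     (\<exists>u R w. Fm u R w \<in> N \<and> Fm u (Neg R) w \<in> N) \<or> (\<exists>u w. Fm u One w \<in> N)"

definition nodes :: "branch \<Rightarrow> fm set set" where
  "nodes \<theta> = insert (leaf \<theta>) (fst ` set (hist \<theta>))"

definition axiomatic_branch :: "branch \<Rightarrow> bool" where
  "axiomatic_branch \<theta> \<longleftrightarrow> (\<exists>N \<in> nodes \<theta>. axiomatic N)"

definition fms :: "branch \<Rightarrow> fm set" where
  "fms \<theta> = \<Union>(nodes \<theta>)"

definition W :: "branch \<Rightarrow> ovar set" where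
  "W \<theta> = lvar ` fms \<theta> \<union> rvar ` fms \<theta>"

definition applied :: "branch \<Rightarrow> inst set" where
  "applied \<theta> = snd ` set (hist \<theta>)"

definition introduced :: "branch \<Rightarrow> ovar set" where
  "introduced \<theta> = {z. \<exists>\<phi>. NegCompI \<phi> z \<in> applied \<theta>}"


fun bool_concl :: "fm \<Rightarrow> fm set list" where
  "bool_concl (Fm u (Cup R S) w) = [{Fm u R w, Fm u S w}]"
| "bool_concl (Fm u (Neg (Cup R S)) w) = [{Fm u (Neg R) w}, {Fm u (Neg S) w}]"
| "bool_concl (Fm u (Cap R S) w) = [{Fm u R w}, {Fm u S w}]"
| "bool_concl (Fm u (Neg (Cap R S)) w) = [{Fm u (Neg R) w, Fm u (Neg S) w}]"
| "bool_concl (Fm u (Neg (Neg R)) w) = [{Fm u R w}]"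
| "bool_concl _ = []"

text \<open>\<open>rule_inst x y \<theta> i \<Gamma>s\<close>: on the branch \<open>\<theta>\<close> of a tree for a formula
  \<open>Fm x P y\<close>, \<open>i\<close> is a correct instance of a rule, with conclusion sets \<open>\<Gamma>s\<close>.\<close>

inductive rule_inst :: "ovar \<Rightarrow> ovar \<Rightarrow> branch \<Rightarrow> inst \<Rightarrow> fm set list \<Rightarrow> bool"
  for x y :: ovar and \<theta> :: branch where
  Boolean: "bool_concl \<phi> \<noteq> [] \<Longrightarrow> rule_inst x y \<theta> (BoolI \<phi>) (bool_concl \<phi>)"
| NegComp: "pos_boolean B \<Longrightarrow> S \<noteq> One \<Longrightarrow> z \<notin> W \<theta> \<Longrightarrow>
    rule_inst x y \<theta> (NegCompI (Fm u (Neg (Comp B S)) y) z)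
      [{Fm u (Neg B) z, Fm z (Neg S) y}]"
| NegComp_One: "pos_boolean B \<Longrightarrow> z \<notin> W \<theta> \<Longrightarrow>
    rule_inst x y \<theta> (NegCompI (Fm u (Neg (Comp B One)) y) z) [{Fm u (Neg B) z}]"
| NegOneComp: "S \<noteq> One \<Longrightarrow> z \<notin> W \<theta> \<Longrightarrow>
    \<forall>z' \<in> introduced \<theta>. Fm z' (Neg S) y \<notin> fms \<theta> \<Longrightarrow>
    rule_inst x y \<theta> (NegCompI (Fm x (Neg (Comp One S)) y) z) [{Fm z (Neg S) y}]"
| CompA: "pos_boolean B \<Longrightarrow> z \<in> V (Neg B) u (fms \<theta>) \<Longrightarrow>
    rule_inst x y \<theta> (CompAI (Fm u (Comp B S) y) z) [{Fm z S y, Fm u (Comp B S) y}]"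
| CompB: "z \<in> W \<theta> \<Longrightarrow> Fm z S y \<notin> fms \<theta> \<Longrightarrow>
    rule_inst x y \<theta> (CompBI (Fm x (Comp One S) y) z) [{Fm z S y, Fm x (Comp One S) y}]"

text \<open>The same rule has already been applied on the branch with the same premise (and,
  for \<open>CompAI\<close> and \<open>CompBI\<close>, with the same variable).\<close>

fun already_applied :: "branch \<Rightarrow> inst \<Rightarrow> bool" where
  "already_applied \<theta> (NegCompI \<phi> z) \<longleftrightarrow> (\<exists>z'. NegCompI \<phi> z' \<in> applied \<theta>)"
| "already_applied \<theta> i \<longleftrightarrow> i \<in> applied \<theta>"


text \<open>The formulae obtained on \<open>\<theta>\<close> from \<open>\<phi>\<close> by Boolean rules.\<close>

inductive_set bool_decomp :: "branch \<Rightarrow> fm \<Rightarrow> fm set" for \<theta> :: branch and \<phi> :: fm where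
  "\<phi> \<in> fms \<theta> \<Longrightarrow> \<phi> \<in> bool_decomp \<theta> \<phi>"
| "\<psi> \<in> bool_decomp \<theta> \<phi> \<Longrightarrow> BoolI \<psi> \<in> applied \<theta> \<Longrightarrow> \<Gamma> \<in> set (bool_concl \<psi>) \<Longrightarrow>
    \<chi> \<in> \<Gamma> \<Longrightarrow> \<chi> \<in> fms \<theta> \<Longrightarrow> \<chi> \<in> bool_decomp \<theta> \<phi>"

text \<open>The literals \<open>z(-r)w\<close> corresponding to the literals \<open>z'(-r)w\<close> obtained on \<open>\<theta>\<close>
  from \<open>z'(-B)w\<close>.\<close>

definition copied_literals :: "branch \<Rightarrow> ovar \<Rightarrow> rterm \<Rightarrow> ovar \<Rightarrow> ovar \<Rightarrow> fm set" where
  "copied_literals \<theta> z' B w z =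
     {Fm z (Neg (RVar r)) w | r. Fm z' (Neg (RVar r)) w \<in> bool_decomp \<theta> (Fm z' (Neg B) w)}"

text \<open>\<open>blocks y \<theta> z' z B S\<close>: the formula \<open>z'(-(B;S))y\<close> blocks \<open>z(-(B;S))y\<close> on \<open>\<theta>\<close>.\<close>

definition blocks ::
  "ovar \<Rightarrow> branch \<Rightarrow> ovar \<Rightarrow> ovar \<Rightarrow> rterm \<Rightarrow> rterm \<Rightarrow> bool" where
  "blocks y \<theta> z' z B S \<longleftrightarrow>
     z' \<noteq> z \<and>
     (\<exists>w. NegCompI (Fm z' (Neg (Comp B S)) y) w \<in> applied \<theta> \<and>
        (\<forall>B1 Q. pos_boolean B1 \<longrightarrow> Fm z (Comp B1 Q) y \<in> fms \<theta> \<longrightarrow>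
           has_Bool_construction (Fm z (Neg B1) w) (copied_literals \<theta> z' B w z) \<longrightarrow>
           Fm z' (Comp B1 Q) y \<in> fms \<theta>))"

definition blocked :: "ovar \<Rightarrow> branch \<Rightarrow> inst \<Rightarrow> bool" where
  "blocked y \<theta> i \<longleftrightarrow>
     (\<exists>z B S v z'. i = NegCompI (Fm z (Neg (Comp B S)) y) v \<and> pos_boolean B \<and>
        blocks y \<theta> z' z B S)"


definition intro_time :: "branch \<Rightarrow> ovar \<Rightarrow> nat" where
  "intro_time \<theta> z = (LEAST k. k < length (hist \<theta>) \<and> (\<exists>\<phi>. snd (hist \<theta> ! k) = NegCompI \<phi> z))"

definition child_rel :: "ovar \<Rightarrow> branch \<Rightarrow> (ovar \<times> ovar) set" where
  "child_rel y \<theta> =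
     {(w, z). \<exists>B S. pos_boolean B \<and> NegCompI (Fm w (Neg (Comp B S)) y) z \<in> applied \<theta>}"

definition descendant :: "ovar \<Rightarrow> branch \<Rightarrow> ovar \<Rightarrow> ovar \<Rightarrow> bool" where
  "descendant y \<theta> w z \<longleftrightarrow> (w, z) \<in> (child_rel y \<theta>)\<^sup>+"

text \<open>For \<open>x \<noteq> y\<close> the order lists \<open>x\<close>, the introduced variables that are not descendants
  of \<open>y\<close>, then \<open>y\<close>, then the descendants of \<open>y\<close>; introduced variables of the same group are
  ordered by time of introduction. For \<open>x = y\<close> the requirement that \<open>x\<close> is least is
  incompatible with placing non-descendants of \<open>y\<close> below \<open>y\<close>; the former is kept.\<close>

definition var_class :: "ovar \<Rightarrow> ovar \<Rightarrow> branch \<Rightarrow> ovar \<Rightarrow> nat" where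
  "var_class x y \<theta> v =
     (if v = x then 0
      else if x = y then 1
      else if v = y then 2
      else if descendant y \<theta> y v then 3
      else 1)"

definition var_less :: "ovar \<Rightarrow> ovar \<Rightarrow> branch \<Rightarrow> ovar \<Rightarrow> ovar \<Rightarrow> bool" where
  "var_less x y \<theta> v w \<longleftrightarrow>
     var_class x y \<theta> v < var_class x y \<theta> w \<or>
     (var_class x y \<theta> v = var_class x y \<theta> w \<and> v \<notin> {x, y} \<and> w \<notin> {x, y} \<and>
      intro_time \<theta> v < intro_time \<theta> w)"


definition permitted :: "ovar \<Rightarrow> ovar \<Rightarrow> branch \<Rightarrow> inst \<Rightarrow> fm set list \<Rightarrow> bool" where
  "permitted x y \<theta> i \<Gamma>s \<longleftrightarrow>
     prem i \<in> leaf \<theta> \<and> rule_inst x y \<theta> i \<Gamma>s \<and>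
     \<not> already_applied \<theta> i \<and> \<not> blocked y \<theta> i"

text \<open>The variable in whose treatment an instance is carried out: the left variable of the
  premise, except that \<open>CompBI\<close> is carried out when its instantiating variable is treated.\<close>

fun focus :: "inst \<Rightarrow> ovar" where
  "focus (BoolI \<phi>) = lvar \<phi>"
| "focus (NegCompI \<phi> z) = lvar \<phi>"
| "focus (CompAI \<phi> z) = lvar \<phi>"
| "focus (CompBI \<phi> z) = z"

fun phase :: "inst \<Rightarrow> nat" where
  "phase (BoolI \<phi>) = 0"
| "phase (NegCompI \<phi> z) = 1"
| "phase (CompAI \<phi> z) = 2"
| "phase (CompBI \<phi> z) = 3"

definition outstanding :: "ovar \<Rightarrow> ovar \<Rightarrow> branch \<Rightarrow> ovar \<Rightarrow> bool" where
  "outstanding x y \<theta> z \<longleftrightarrow> (\<exists>i \<Gamma>s. permitted x y \<theta> i \<Gamma>s \<and> focus i = z)"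

definition expandable :: "ovar \<Rightarrow> ovar \<Rightarrow> branch \<Rightarrow> bool" where
  "expandable x y \<theta> \<longleftrightarrow> (\<exists>i \<Gamma>s. permitted x y \<theta> i \<Gamma>s)"

definition smallest_outstanding :: "ovar \<Rightarrow> ovar \<Rightarrow> branch \<Rightarrow> ovar \<Rightarrow> bool" where
  "smallest_outstanding x y \<theta> z \<longleftrightarrow>
     outstanding x y \<theta> z \<and>
     (\<forall>z'. outstanding x y \<theta> z' \<longrightarrow> z' \<noteq> z \<longrightarrow> var_less x y \<theta> z z')"

definition closed_tree :: "dtree \<Rightarrow> bool" where
  "closed_tree t \<longleftrightarrow> (\<forall>p \<theta>. branch_at t p \<theta> \<longrightarrow> axiomatic_branch \<theta>)"

text \<open>\<open>Select t\<close>: a branch of \<open>t\<close> is to be chosen. \<open>Loop t p\<close>: head of the while loop for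
  the branch at \<open>p\<close>. \<open>Treat t p z\<close>: inside the body of the loop, with the variable \<open>z\<close>.
  \<open>ProofTree t\<close> and \<open>OpenBranch \<theta>\<close> are the two kinds of result.\<close>

datatype pstate =
    Select dtree
  | Loop dtree "nat list"
  | Treat dtree "nat list" ovar
  | ProofTree dtree
  | OpenBranch branch

text \<open>\<open>expand\<close> applies a rule of the least applicable phase, so that Boolean rules are also
  exhausted on the formulae produced by later phases. After branching, the treatment
  continues with an arbitrary one (index \<open>k\<close>) of the new branches. The side conditions of
  \<open>NegCompI\<close> leave the choice of the new variable open.\<close>

inductive proc_step :: "ovar \<Rightarrow> ovar \<Rightarrow> pstate \<Rightarrow> pstate \<Rightarrow> bool" for x y :: ovar where
  select: "branch_at t p \<theta> \<Longrightarrow> \<not> axiomatic_branch \<theta> \<Longrightarrow>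
    proc_step x y (Select t) (Loop t p)"
| select_none: "closed_tree t \<Longrightarrow> proc_step x y (Select t) (ProofTree t)"
| enter: "branch_at t p \<theta> \<Longrightarrow> \<not> axiomatic_branch \<theta> \<Longrightarrow>
    smallest_outstanding x y \<theta> z \<Longrightarrow>
    proc_step x y (Loop t p) (Treat t p z)"
| expand: "branch_at t p \<theta> \<Longrightarrow> \<not> axiomatic_branch \<theta> \<Longrightarrow>
    permitted x y \<theta> i \<Gamma>s \<Longrightarrow> focus i = z \<Longrightarrow>
    \<forall>j \<Delta>s. permitted x y \<theta> j \<Delta>s \<longrightarrow> focus j = z \<longrightarrow> phase i \<le> phase j \<Longrightarrow>
    k < length \<Gamma>s \<Longrightarrow>
    proc_step x y (Treat t p z) (Treat (extend t p i \<Gamma>s) (p @ [k]) z)"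
| leave: "branch_at t p \<theta> \<Longrightarrow> axiomatic_branch \<theta> \<or> \<not> outstanding x y \<theta> z \<Longrightarrow>
    proc_step x y (Treat t p z) (Loop t p)"
| stop_closed: "branch_at t p \<theta> \<Longrightarrow> axiomatic_branch \<theta> \<Longrightarrow> closed_tree t \<Longrightarrow>
    proc_step x y (Loop t p) (ProofTree t)"
| next_branch: "branch_at t p \<theta> \<Longrightarrow> axiomatic_branch \<theta> \<Longrightarrow> \<not> closed_tree t \<Longrightarrow>
    proc_step x y (Loop t p) (Select t)"
| stop_open: "branch_at t p \<theta> \<Longrightarrow> \<not> axiomatic_branch \<theta> \<Longrightarrow> \<not> expandable x y \<theta> \<Longrightarrow>
    proc_step x y (Loop t p) (OpenBranch \<theta>)"

fun is_result :: "pstate \<Rightarrow> bool" where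
  "is_result (ProofTree t) = True"
| "is_result (OpenBranch \<theta>) = True"
| "is_result _ = False"

definition initial_tree :: "fm \<Rightarrow> dtree" where
  "initial_tree \<phi> = Leaf {\<phi>}"

text \<open>The procedure is nondeterministic: it terminates from a state if no run from there is
  infinite, and a run can end only in a result.\<close>

definition always_terminates :: "ovar \<Rightarrow> ovar \<Rightarrow> pstate \<Rightarrow> bool" where
  "always_terminates x y s \<longleftrightarrow>
     \<not> (\<exists>run :: nat \<Rightarrow> pstate. run 0 = s \<and> (\<forall>n. proc_step x y (run n) (run (Suc n)))) \<and>
     (\<forall>s'. (proc_step x y)\<^sup>*\<^sup>* s s' \<longrightarrow> \<not> (\<exists>s''. proc_step x y s' s'') \<longrightarrow> is_result s')"

end

(* Along a branch only finitely many terms occur, namely subterms of P and their complements.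
   Attach to every decomposed formula u(-(B;S))y the pair of its term and the set of terms R
   such that uRy was on the branch at the moment of decomposition. Since sets of formulae only
   grow along a branch, two decompositions with the same pair would make the earlier formula
   block the later one. Hence the number of new variables, and with it the length of a branch,
   is bounded in terms of P alone, whatever order of variables the procedure follows. As rules
   branch at most twice, the sum of 3^(M - length) over all branches, with M the bound, drops
   at each rule application, and only boundedly many other steps lie between two of those. *)

theory Submission
  imports Defs
begin

section \<open>Extending a branch\<close>

definition child :: "branch \<Rightarrow> inst \<Rightarrow> fm set \<Rightarrow> branch" where
  "child \<theta> i \<Gamma> = Branch (hist \<theta> @ [(leaf \<theta>, i)]) (leaf \<theta> - {prem i} \<union> \<Gamma>)"

lemma hist_child [simp]: "hist (child \<theta> i \<Gamma>) = hist \<theta> @ [(leaf \<theta>, i)]"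
  by (simp add: child_def)

lemma applied_child [simp]: "applied (child \<theta> i \<Gamma>) = insert i (applied \<theta>)"
  by (auto simp: applied_def)

text \<open>The old leaf stays on the branch as an inner node, so deleting the premise from the new
  leaf loses nothing: formulae only accumulate.\<close>

lemma fms_child [simp]: "fms (child \<theta> i \<Gamma>) = fms \<theta> \<union> \<Gamma>"
  by (auto simp: fms_def nodes_def child_def)

lemma W_child [simp]: "W (child \<theta> i \<Gamma>) = W \<theta> \<union> lvar ` \<Gamma> \<union> rvar ` \<Gamma>"
  by (auto simp: W_def)

lemma leaf_subset_fms: "leaf \<theta> \<subseteq> fms \<theta>"
  by (auto simp: fms_def nodes_def)

lemma fms_vars:
  assumes "Fm u R w \<in> fms \<theta>"
  shows "u \<in> W \<theta>" and "w \<in> W \<theta>"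
  using assms unfolding W_def by force+

text \<open>\<open>rank\<close> refers to the branch at a path existentially; uniqueness identifies
  it with the branch named in a procedure step.\<close>

lemma branch_at_fun: "branch_at t p \<theta> \<Longrightarrow> branch_at t p \<theta>' \<Longrightarrow> \<theta>' = \<theta>"
proof (induction arbitrary: \<theta>' rule: branch_at.induct)
  case (1 N)
  then show ?case by (auto elim: branch_at.cases)
next
  case (2 k ts p h L N i)
  from "2.prems" obtain h' L' where "branch_at (ts ! k) p (Branch h' L')"
    and "\<theta>' = Branch ((N, i) # h') L'"
    by (auto elim: branch_at.cases)
  then show ?case using "2.IH" by blast
qed

lemma branch_at_extend_child:
  "branch_at t p \<theta> \<Longrightarrow> k < length \<Gamma>s \<Longrightarrow>
   branch_at (extend t p i \<Gamma>s) (p @ [k]) (child \<theta> i (\<Gamma>s ! k))"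
proof (induction rule: branch_at.induct)
  case (1 N)
  then show ?case
    using branch_at.intros(2)[of k "map (\<lambda>\<Gamma>. Leaf (N - {prem i} \<union> \<Gamma>)) \<Gamma>s" "[]" "[]"]
    by (simp add: child_def branch_at.intros(1))
next
  case (2 k' ts p h L N j)
  then show ?case
    using branch_at.intros(2)[of k' "ts[k' := extend (ts ! k') p i \<Gamma>s]" "p @ [k]"]
    by (simp add: child_def)
qed

lemma branch_at_extendD:
  "branch_at t p \<theta> \<Longrightarrow> branch_at (extend t p i \<Gamma>s) q \<theta>' \<Longrightarrow>
   branch_at t q \<theta>' \<or> (\<exists>\<Gamma> \<in> set \<Gamma>s. \<theta>' = child \<theta> i \<Gamma>)"
proof (induction arbitrary: q \<theta>' rule: branch_at.induct)
  case (1 N)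
  from "1.prems" show ?case
    by (auto elim!: branch_at.cases[of "Inner _ _ _"] branch_at.cases[of "Leaf _"]
        simp: child_def)
next
  case (2 k ts p h L N j)
  from "2.prems" obtain k' q' h' L'
    where k': "q = k' # q'" "\<theta>' = Branch ((N, j) # h') L'" "k' < length ts"
      and b: "branch_at (ts[k := extend (ts ! k) p i \<Gamma>s] ! k') q' (Branch h' L')"
    by (auto elim: branch_at.cases)
  show ?case
  proof (cases "k' = k")
    case True
    with b k' have "branch_at (extend (ts ! k) p i \<Gamma>s) q' (Branch h' L')" by simp
    from "2.IH"[OF this] show ?thesis
    proof
      assume "branch_at (ts ! k) q' (Branch h' L')"
      with k' True show ?thesis by (simp add: branch_at.intros(2))
    qed (auto simp: child_def k')
  next
    case False
    with b k' show ?thesis by (simp add: branch_at.intros(2))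
  qed
qed

section \<open>Terms and variables on a branch\<close>

primrec subterms :: "rterm \<Rightarrow> rterm set" where
  "subterms (RVar r) = {RVar r}"
| "subterms One = {One}"
| "subterms (Neg R) = insert (Neg R) (subterms R)"
| "subterms (Cup R S) = insert (Cup R S) (subterms R \<union> subterms S)"
| "subterms (Cap R S) = insert (Cap R S) (subterms R \<union> subterms S)"
| "subterms (Comp R S) = insert (Comp R S) (subterms R \<union> subterms S)"

text \<open>One complement around each subterm suffices: the rules move a complement to the
  immediate parts of a term and strip double complements.\<close>

definition neg_closure :: "rterm \<Rightarrow> rterm set" where
  "neg_closure P = subterms P \<union> Neg ` subterms P"

lemma subterms_refl [simp]: "R \<in> subterms R"
  by (cases R) auto

lemma subterms_trans: "R \<in> subterms P \<Longrightarrow> S \<in> subterms R \<Longrightarrow> S \<in> subterms P"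
  by (induction P) auto

lemma subterms_closed:
  "Neg R \<in> subterms P \<Longrightarrow> R \<in> subterms P"
  "Cup R S \<in> subterms P \<Longrightarrow> R \<in> subterms P" "Cup R S \<in> subterms P \<Longrightarrow> S \<in> subterms P"
  "Cap R S \<in> subterms P \<Longrightarrow> R \<in> subterms P" "Cap R S \<in> subterms P \<Longrightarrow> S \<in> subterms P"
  "Comp R S \<in> subterms P \<Longrightarrow> R \<in> subterms P" "Comp R S \<in> subterms P \<Longrightarrow> S \<in> subterms P"
  by (erule subterms_trans, simp)+

lemma finite_neg_closure: "finite (neg_closure P)"
proof -
  have "finite (subterms P)" by (induction P) auto
  then show ?thesis by (simp add: neg_closure_def)
qed

lemma neg_closure_closed:
  "Cup R S \<in> neg_closure P \<Longrightarrow> R \<in> neg_closure P \<and> S \<in> neg_closure P"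
  "Cap R S \<in> neg_closure P \<Longrightarrow> R \<in> neg_closure P \<and> S \<in> neg_closure P"
  "Comp R S \<in> neg_closure P \<Longrightarrow> R \<in> neg_closure P \<and> S \<in> neg_closure P"
  "Neg (Cup R S) \<in> neg_closure P \<Longrightarrow> Neg R \<in> neg_closure P \<and> Neg S \<in> neg_closure P"
  "Neg (Cap R S) \<in> neg_closure P \<Longrightarrow> Neg R \<in> neg_closure P \<and> Neg S \<in> neg_closure P"
  "Neg (Comp R S) \<in> neg_closure P \<Longrightarrow> Neg R \<in> neg_closure P \<and> Neg S \<in> neg_closure P"
  "Neg (Neg R) \<in> neg_closure P \<Longrightarrow> R \<in> neg_closure P"
  unfolding neg_closure_def by (blast dest: subterms_closed)+

lemma bool_concl_closed:
  assumes "\<Gamma> \<in> set (bool_concl \<phi>)" and "\<psi> \<in> \<Gamma>"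
  shows "lvar \<psi> = lvar \<phi>" and "rvar \<psi> = rvar \<phi>"
    and "trm \<phi> \<in> neg_closure P \<Longrightarrow> trm \<psi> \<in> neg_closure P"
  using assms by (induction \<phi> rule: bool_concl.induct) (auto dest: neg_closure_closed)

lemma length_bool_concl: "length (bool_concl \<phi>) \<le> 2"
  by (induction \<phi> rule: bool_concl.induct) auto

text \<open>A Bool-construction rests on at least one literal and keeps its variables. Hence
  \<open>CompAI\<close> can only use variables already present.\<close>

lemma Bool_fms_literal: "\<phi> \<in> Bool_fms N \<Longrightarrow> \<exists>\<psi> \<in> N. rvar \<psi> = rvar \<phi>"
  by (induction rule: Bool_fms.induct) auto

lemma V_subset_W: "V R u (fms \<theta>) \<subseteq> W \<theta>"
  by (fastforce simp: V_def W_def dest: Bool_fms_literal)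

lemma rule_inst_length:
  assumes "rule_inst x y \<theta> i \<Gamma>s"
  shows "\<Gamma>s \<noteq> []" and "length \<Gamma>s \<le> 2"
  using assms by (cases; simp add: length_bool_concl)+

lemma rule_inst_trm:
  assumes "rule_inst x y \<theta> i \<Gamma>s" and "trm (prem i) \<in> neg_closure P" and "\<Gamma> \<in> set \<Gamma>s"
  shows "trm ` \<Gamma> \<subseteq> neg_closure P"
  using assms by cases (auto dest: neg_closure_closed intro: bool_concl_closed(3))

section \<open>Introduced variables and derivable branches\<close>

definition new_var :: "inst \<Rightarrow> ovar set" where
  "new_var i = {z. \<exists>\<phi>. i = NegCompI \<phi> z}"

lemma new_var_simps [simp]:
  "new_var (BoolI \<phi>) = {}" "new_var (NegCompI \<phi> z) = {z}"
  "new_var (CompAI \<phi> z) = {}" "new_var (CompBI \<phi> z) = {}"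
  by (auto simp: new_var_def)

lemma introduced_child [simp]: "introduced (child \<theta> i \<Gamma>) = new_var i \<union> introduced \<theta>"
  by (auto simp: introduced_def new_var_def)

lemma rule_inst_vars:
  assumes "rule_inst x y \<theta> i \<Gamma>s" and "prem i \<in> fms \<theta>" and "\<Gamma> \<in> set \<Gamma>s"
  shows "lvar ` \<Gamma> \<union> rvar ` \<Gamma> \<subseteq> insert y (W \<theta> \<union> new_var i)"
  using assms
proof cases
  case (Boolean \<phi>)
  then have "lvar \<phi> \<in> W \<theta>" "rvar \<phi> \<in> W \<theta>"
    using assms(2) by (auto simp: W_def)
  then show ?thesis
    using Boolean assms(3) by (auto simp: bool_concl_closed)
next
  case (CompA B z u S)
  then show ?thesis using assms V_subset_W by (auto dest: fms_vars)
qed (use assms in \<open>auto dest: fms_vars\<close>)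

text \<open>Over-approximates the branches that the procedure builds: permitted instances may come
  in any order of variables and phases, so bounds proved here do not depend on the strategy.\<close>

inductive derived :: "ovar \<Rightarrow> ovar \<Rightarrow> rterm \<Rightarrow> branch \<Rightarrow> bool" for x y P where
  init: "derived x y P (Branch [] {Fm x P y})"
| step: "derived x y P \<theta> \<Longrightarrow> permitted x y \<theta> i \<Gamma>s \<Longrightarrow> \<Gamma> \<in> set \<Gamma>s \<Longrightarrow>
    derived x y P (child \<theta> i \<Gamma>)"

lemma permittedD:
  assumes "permitted x y \<theta> i \<Gamma>s"
  shows "rule_inst x y \<theta> i \<Gamma>s" and "prem i \<in> fms \<theta>" and "i \<notin> applied \<theta>"
    and "\<not> blocked y \<theta> i"
proof -
  \<comment> \<open>For \<open>NegCompI\<close>, \<open>already_applied\<close> ignores the new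
    variable and so excludes more than \<open>i\<close> itself.\<close>
  show "i \<notin> applied \<theta>"
    using assms unfolding permitted_def by (cases i) auto
qed (use assms leaf_subset_fms in \<open>auto simp: permitted_def\<close>)

lemma derived_trm: "derived x y P \<theta> \<Longrightarrow> trm ` fms \<theta> \<subseteq> neg_closure P"
proof (induction rule: derived.induct)
  case init
  then show ?case by (simp add: fms_def nodes_def neg_closure_def)
next
  case (step \<theta> i \<Gamma>s \<Gamma>)
  have "trm ` \<Gamma> \<subseteq> neg_closure P"
    using rule_inst_trm[OF permittedD(1)[OF step.hyps(2)] _ step.hyps(3)]
      permittedD(2)[OF step.hyps(2)] step.IH by blast
  with step.IH show ?case by auto
qed

lemma derived_W: "derived x y P \<theta> \<Longrightarrow> W \<theta> \<subseteq> {x, y} \<union> introduced \<theta>"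
proof (induction rule: derived.induct)
  case init
  then show ?case by (simp add: W_def fms_def nodes_def)
next
  case (step \<theta> i \<Gamma>s \<Gamma>)
  from rule_inst_vars[OF permittedD(1,2)[OF step.hyps(2)] step.hyps(3)] step.IH
  show ?case by auto
qed

section \<open>Bounding the length of a branch\<close>

definition decomposed :: "branch \<Rightarrow> fm set" where
  "decomposed \<theta> = {\<phi>. \<exists>z. NegCompI \<phi> z \<in> applied \<theta>}"

definition terms_at :: "ovar \<Rightarrow> branch \<Rightarrow> ovar \<Rightarrow> rterm set" where
  "terms_at y \<theta> u = {R. Fm u R y \<in> fms \<theta>}"

lemma terms_at_child: "terms_at y \<theta> u \<subseteq> terms_at y (child \<theta> i \<Gamma>) u"
  by (auto simp: terms_at_def)

lemma terms_at_derived: "derived x y P \<theta> \<Longrightarrow> terms_at y \<theta> u \<subseteq> neg_closure P"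
  using derived_trm by (force simp: terms_at_def)

text \<open>The shape of a premise of a (-;)-rule. When \<open>B\<close> is \<open>One\<close>, the
  left variable is fixed to be \<open>x\<close>, so the term determines the formula.\<close>

definition neg_comp_fm :: "ovar \<Rightarrow> ovar \<Rightarrow> fm \<Rightarrow> bool" where
  "neg_comp_fm x y \<phi> \<longleftrightarrow>
     (\<exists>u B S. \<phi> = Fm u (Neg (Comp B S)) y \<and> (pos_boolean B \<or> B = One \<and> u = x))"

lemma rule_inst_neg_comp_fm:
  "rule_inst x y \<theta> (NegCompI \<phi> z) \<Gamma>s \<Longrightarrow> neg_comp_fm x y \<phi>"
  by (cases rule: rule_inst.cases) (auto simp: neg_comp_fm_def)

text \<open>Otherwise \<psi> would block \<phi>. Inclusion of all terms towards \<open>y\<close>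
  implies the blocking condition, whichever Bool-constructions exist.\<close>

lemma permitted_not_covered:
  assumes perm: "permitted x y \<theta> (NegCompI \<phi> z) \<Gamma>s"
    and \<psi>: "\<psi> \<in> decomposed \<theta>" "neg_comp_fm x y \<psi>" "trm \<psi> = trm \<phi>"
  shows "\<not> terms_at y \<theta> (lvar \<phi>) \<subseteq> terms_at y \<theta> (lvar \<psi>)"
proof
  assume sub: "terms_at y \<theta> (lvar \<phi>) \<subseteq> terms_at y \<theta> (lvar \<psi>)"
  have "\<psi> \<noteq> \<phi>"
    using perm \<psi>(1) by (auto simp: permitted_def decomposed_def)
  have "neg_comp_fm x y \<phi>"
    using permittedD(1)[OF perm] by (rule rule_inst_neg_comp_fm)
  then obtain u B S where \<phi>: "\<phi> = Fm u (Neg (Comp B S)) y"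
    and u: "pos_boolean B \<or> B = One \<and> u = x"
    unfolding neg_comp_fm_def by blast
  with \<psi>(2,3) obtain v where v: "\<psi> = Fm v (Neg (Comp B S)) y"
    and "pos_boolean B \<or> B = One \<and> v = x"
    unfolding neg_comp_fm_def by auto
  \<comment> \<open>Distinct formulae with equal terms and right variable \<open>y\<close> differ on
    the left; \<open>B = One\<close> would make both left variables \<open>x\<close>.\<close>
  with u \<phi> \<open>\<psi> \<noteq> \<phi>\<close> have "v \<noteq> u" "pos_boolean B" by auto
  note eq = \<phi> v
  have "Fm v R y \<in> fms \<theta>" if "Fm u R y \<in> fms \<theta>" for R
    using sub that eq by (auto simp: terms_at_def)
  then have "blocks y \<theta> v u B S"
    using \<psi>(1) eq \<open>v \<noteq> u\<close> by (auto simp: blocks_def decomposed_def)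
  with \<phi> \<open>pos_boolean B\<close> have "blocked y \<theta> (NegCompI \<phi> z)"
    by (auto simp: blocked_def)
  with permittedD(4)[OF perm] show False by simp
qed

text \<open>\<kappa> \<phi> stands for the terms at the left variable of \<phi> when \<phi> was
  decomposed. Only its inclusion in the current terms is kept, which survives growth of the
  branch.\<close>

definition key_for :: "ovar \<Rightarrow> ovar \<Rightarrow> rterm \<Rightarrow> branch \<Rightarrow> (fm \<Rightarrow> rterm set) \<Rightarrow> bool" where
  "key_for x y P \<theta> \<kappa> \<longleftrightarrow>
     inj_on (\<lambda>\<phi>. (trm \<phi>, \<kappa> \<phi>)) (decomposed \<theta>) \<and>
     (\<forall>\<phi> \<in> decomposed \<theta>. neg_comp_fm x y \<phi> \<and> trm \<phi> \<in> neg_closure P \<and>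
        \<kappa> \<phi> \<subseteq> neg_closure P \<and> \<kappa> \<phi> \<subseteq> terms_at y \<theta> (lvar \<phi>))"

lemma decomposed_child:
  "decomposed (child \<theta> i \<Gamma>) =
     (case i of NegCompI \<phi> z \<Rightarrow> insert \<phi> (decomposed \<theta>) | _ \<Rightarrow> decomposed \<theta>)"
  by (cases i) (auto simp: decomposed_def)

lemma derived_key: "derived x y P \<theta> \<Longrightarrow> \<exists>\<kappa>. key_for x y P \<theta> \<kappa>"
proof (induction rule: derived.induct)
  case init
  then show ?case by (simp add: key_for_def decomposed_def applied_def)
next
  case (step \<theta> i \<Gamma>s \<Gamma>)
  then obtain \<kappa> where \<kappa>: "key_for x y P \<theta> \<kappa>" by blast
  show ?case
  proof (cases "\<exists>\<phi> z. i = NegCompI \<phi> z")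
    case False
    then have "decomposed (child \<theta> i \<Gamma>) = decomposed \<theta>"
      by (auto simp: decomposed_child split: inst.split)
    with \<kappa> have "key_for x y P (child \<theta> i \<Gamma>) \<kappa>"
      using terms_at_child unfolding key_for_def by (metis order_trans)
    then show ?thesis by blast
  next
    case True
    then obtain \<phi> z where i: "i = NegCompI \<phi> z" by blast
    \<comment> \<open>The newly decomposed formula receives the current set of terms as its
      key.\<close>
    let ?\<kappa> = "\<kappa>(\<phi> := terms_at y \<theta> (lvar \<phi>))"
    have perm: "permitted x y \<theta> (NegCompI \<phi> z) \<Gamma>s" using step.hyps(2) i by simp
    have notin: "\<phi> \<notin> decomposed \<theta>"
      using perm by (auto simp: permitted_def decomposed_def)
    \<comment> \<open>Equal keys would give
      \<open>terms_at y \<theta> (lvar \<phi>) = \<kappa> \<psi>\<close>, a subset of the current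
      terms at the left variable of \<psi>, so \<psi> would block \<phi>.\<close>
    have new: "(trm \<phi>, terms_at y \<theta> (lvar \<phi>)) \<noteq> (trm \<psi>, \<kappa> \<psi>)" if "\<psi> \<in> decomposed \<theta>" for \<psi>
      using permitted_not_covered[OF perm that] \<kappa> that by (auto simp: key_for_def)
    have "inj_on (\<lambda>\<psi>. (trm \<psi>, ?\<kappa> \<psi>)) (decomposed \<theta>)"
      using \<kappa> notin unfolding key_for_def inj_on_def by auto
    moreover have "(trm \<phi>, ?\<kappa> \<phi>) \<notin> (\<lambda>\<psi>. (trm \<psi>, ?\<kappa> \<psi>)) ` (decomposed \<theta> - {\<phi>})"
      using new by (auto simp: image_iff)
    ultimately have "inj_on (\<lambda>\<psi>. (trm \<psi>, ?\<kappa> \<psi>)) (insert \<phi> (decomposed \<theta>))"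
      by (simp only: inj_on_insert simp_thms)
    moreover have "neg_comp_fm x y \<psi> \<and> trm \<psi> \<in> neg_closure P \<and> ?\<kappa> \<psi> \<subseteq> neg_closure P \<and>
        ?\<kappa> \<psi> \<subseteq> terms_at y (child \<theta> i \<Gamma>) (lvar \<psi>)" if "\<psi> \<in> insert \<phi> (decomposed \<theta>)" for \<psi>
    proof (cases "\<psi> = \<phi>")
      case True
      have "trm \<phi> \<in> neg_closure P"
        using permittedD(2)[OF perm] derived_trm[OF step.hyps(1)] by auto
      then show ?thesis
        using True rule_inst_neg_comp_fm[OF permittedD(1)[OF perm]]
          terms_at_derived[OF step.hyps(1)] terms_at_child by simp
    next
      case False
      with that have "\<psi> \<in> decomposed \<theta>" by simp
      with \<kappa> False show ?thesis
        using terms_at_child[of y \<theta> "lvar \<psi>" i \<Gamma>] by (auto simp: key_for_def)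
    qed
    ultimately have "key_for x y P (child \<theta> i \<Gamma>) ?\<kappa>"
      by (simp add: key_for_def decomposed_child i)
    then show ?thesis by blast
  qed
qed

text \<open>Each (-;)-step adds one variable and consumes a premise not decomposed before, so the
  second count keeps pace with the first.\<close>

lemma derived_card_introduced:
  "derived x y P \<theta> \<Longrightarrow>
   finite (decomposed \<theta>) \<and> finite (introduced \<theta>) \<and> card (introduced \<theta>) \<le> card (decomposed \<theta>)"
proof (induction rule: derived.induct)
  case init
  then show ?case by (simp add: introduced_def decomposed_def applied_def)
next
  case (step \<theta> i \<Gamma>s \<Gamma>)
  show ?case
  proof (cases i)
    case (NegCompI \<phi> z)
    then have "\<phi> \<notin> decomposed \<theta>"
      using step.hyps(2) by (auto simp: permitted_def decomposed_def)
    then show ?thesis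
      using NegCompI step.IH by (simp add: decomposed_child card_insert_if)
  qed (use step.IH in \<open>simp_all add: decomposed_child\<close>)
qed

section \<open>Bounding the number of variables\<close>

definition var_bound :: "rterm \<Rightarrow> nat" where
  "var_bound P = 2 + card (neg_closure P \<times> Pow (neg_closure P))"

lemma card_W_le:
  assumes "derived x y P \<theta>"
  shows "finite (W \<theta> \<union> introduced \<theta>)" and "card (W \<theta> \<union> introduced \<theta>) \<le> var_bound P"
proof -
  note c = derived_card_introduced[OF assms]
  have sub: "W \<theta> \<union> introduced \<theta> \<subseteq> {x, y} \<union> introduced \<theta>"
    using derived_W[OF assms] by auto
  with c show "finite (W \<theta> \<union> introduced \<theta>)"
    by (meson finite.intros finite_UnI finite_subset)
  obtain \<kappa> where \<kappa>: "key_for x y P \<theta> \<kappa>" using derived_key[OF assms] ..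
  have "card (W \<theta> \<union> introduced \<theta>) \<le> card ({x, y} \<union> introduced \<theta>)"
    using sub c by (intro card_mono) auto
  also have "\<dots> \<le> card {x, y} + card (introduced \<theta>)" by (rule card_Un_le)
  also have "\<dots> \<le> 2 + card (decomposed \<theta>)"
    using c by (simp add: card_insert_if)
  \<comment> \<open>The keys inject the decomposed formulae into pairs of a term and a set of terms
    over \<open>neg_closure P\<close>.\<close>
  also have "card (decomposed \<theta>) \<le> card (neg_closure P \<times> Pow (neg_closure P))"
    using \<kappa> by (intro card_inj_on_le[of "\<lambda>\<phi>. (trm \<phi>, \<kappa> \<phi>)"])
      (auto simp: key_for_def finite_neg_closure)
  finally show "card (W \<theta> \<union> introduced \<theta>) \<le> var_bound P"
    by (simp add: var_bound_def)
qed

section \<open>Counting rule instances over finitely many variables\<close>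

definition insts_over :: "ovar set \<Rightarrow> rterm set \<Rightarrow> inst set" where
  "insts_over X C = (\<lambda>(f, (u, R, w), z). f (Fm u R w) z) `
     ({\<lambda>\<phi> z. BoolI \<phi>, NegCompI, CompAI, CompBI} \<times> (X \<times> C \<times> X) \<times> X)"

text \<open>\<open>insts_over\<close> is the image of a product, so the bound multiplies its
  factors: four rules, two variables and a term for the premise, and one further variable, which
  \<open>BoolI\<close> ignores.\<close>

lemma card_insts_over:
  assumes "finite X" and "finite C"
  shows "finite (insts_over X C)"
    and "card (insts_over X C) \<le> 4 * (card X * card C * card X * card X)"
proof -
  let ?K = "{\<lambda>\<phi> z. BoolI \<phi>, NegCompI, CompAI, CompBI}"
  \<comment> \<open>Bounding by the length of a list avoids showing that the four functions are
    distinct.\<close>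
  have "card ?K \<le> 4"
    using card_length[of "[\<lambda>\<phi> z. BoolI \<phi>, NegCompI, CompAI, CompBI]"] by simp
  then have "card (?K \<times> (X \<times> C \<times> X) \<times> X) \<le> 4 * (card X * card C * card X * card X)"
    by (simp only: card_cartesian_product mult.assoc mult_le_mono1)
  moreover have "finite (?K \<times> (X \<times> C \<times> X) \<times> X)" using assms by simp
  ultimately show "finite (insts_over X C)"
    and "card (insts_over X C) \<le> 4 * (card X * card C * card X * card X)"
    unfolding insts_over_def by (blast intro: card_image_le order_trans)+
qed

lemma insts_overI:
  assumes "u \<in> X" "R \<in> C" "w \<in> X"
  shows "BoolI (Fm u R w) \<in> insts_over X C"
    and "z \<in> X \<Longrightarrow> NegCompI (Fm u R w) z \<in> insts_over X C"
    and "z \<in> X \<Longrightarrow> CompAI (Fm u R w) z \<in> insts_over X C"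
    and "z \<in> X \<Longrightarrow> CompBI (Fm u R w) z \<in> insts_over X C"
  unfolding insts_over_def using assms by force+

lemma insts_over_mono: "X \<subseteq> Y \<Longrightarrow> insts_over X C \<subseteq> insts_over Y C"
  unfolding insts_over_def by (intro image_mono Sigma_mono) auto

lemma permitted_insts_over:
  assumes "derived x y P \<theta>" and perm: "permitted x y \<theta> i \<Gamma>s"
  shows "i \<in> insts_over (W \<theta> \<union> new_var i) (neg_closure P)"
proof -
  obtain u R w where \<phi>: "prem i = Fm u R w" by (cases "prem i")
  have "Fm u R w \<in> fms \<theta>" using permittedD(2)[OF perm] \<phi> by simp
  then have u: "u \<in> W \<theta>" "w \<in> W \<theta>" "R \<in> neg_closure P"
    using fms_vars derived_trm[OF assms(1)] by force+
  from permittedD(1)[OF perm] show ?thesis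
  proof cases
    case (CompA B z v S)
    then have "z \<in> W \<theta>" using V_subset_W by blast
    then show ?thesis using CompA \<phi> u by (auto intro!: insts_overI)
  qed (use \<phi> u in \<open>auto intro!: insts_overI\<close>)
qed

text \<open>No instance is applied twice, so the history is as long as the set of applied instances
  is large, and counting instances bounds the branch.\<close>

lemma derived_applied:
  "derived x y P \<theta> \<Longrightarrow>
   applied \<theta> \<subseteq> insts_over (W \<theta> \<union> introduced \<theta>) (neg_closure P) \<and>
   length (hist \<theta>) = card (applied \<theta>)"
proof (induction rule: derived.induct)
  case init
  then show ?case by (simp add: applied_def)
next
  case (step \<theta> i \<Gamma>s \<Gamma>)
  let ?X = "W (child \<theta> i \<Gamma>) \<union> introduced (child \<theta> i \<Gamma>)"
  have "insts_over (W \<theta> \<union> new_var i) (neg_closure P) \<subseteq> insts_over ?X (neg_closure P)"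
    "insts_over (W \<theta> \<union> introduced \<theta>) (neg_closure P) \<subseteq> insts_over ?X (neg_closure P)"
    by (intro insts_over_mono; auto)+
  with permitted_insts_over[OF step.hyps(1,2)] step.IH
  have "applied (child \<theta> i \<Gamma>) \<subseteq> insts_over ?X (neg_closure P)" by auto
  moreover have "finite (applied \<theta>)" by (simp add: applied_def)
  ultimately show ?case
    using step.IH permittedD(3)[OF step.hyps(2)] by simp
qed

definition length_bound :: "rterm \<Rightarrow> nat" where
  "length_bound P =
     4 * (var_bound P * card (neg_closure P) * var_bound P * var_bound P)"

lemma derived_length_le:
  assumes "derived x y P \<theta>"
  shows "length (hist \<theta>) \<le> length_bound P"
proof -
  let ?X = "W \<theta> \<union> introduced \<theta>"
  note X = card_W_le[OF assms]
  have "length (hist \<theta>) \<le> card (insts_over ?X (neg_closure P))"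
    using derived_applied[OF assms] card_insts_over(1)[OF X(1) finite_neg_closure]
    by (simp add: card_mono)
  also have "\<dots> \<le> 4 * (card ?X * card (neg_closure P) * card ?X * card ?X)"
    using X(1) finite_neg_closure by (rule card_insts_over)
  also have "\<dots> \<le> length_bound P"
    unfolding length_bound_def using X(2) by (intro mult_le_mono order_refl)
  finally show ?thesis .
qed

section \<open>The order on outstanding variables\<close>

text \<open>The history entry at the common time is a single \<open>NegCompI\<close>, which
  introduces only one variable.\<close>

lemma intro_time_inj:
  assumes "v \<in> introduced \<theta>" "w \<in> introduced \<theta>" "intro_time \<theta> v = intro_time \<theta> w"
  shows "v = w"
proof -
  have ex: "\<exists>\<phi>. snd (hist \<theta> ! intro_time \<theta> z) = NegCompI \<phi> z" if "z \<in> introduced \<theta>" for z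
  proof -
    from that obtain N \<phi> where "(N, NegCompI \<phi> z) \<in> set (hist \<theta>)"
      by (auto simp: introduced_def applied_def)
    then obtain k where "k < length (hist \<theta>)" "hist \<theta> ! k = (N, NegCompI \<phi> z)"
      unfolding in_set_conv_nth by blast
    then have "\<exists>k. k < length (hist \<theta>) \<and> (\<exists>\<phi>. snd (hist \<theta> ! k) = NegCompI \<phi> z)"
      by (metis snd_conv)
    from LeastI_ex[OF this] show ?thesis unfolding intro_time_def by blast
  qed
  from ex[OF assms(1)] ex[OF assms(2)] show ?thesis
    unfolding assms(3) by (metis inst.inject(2))
qed

lemma outstanding_in_W:
  assumes "outstanding x y \<theta> z"
  shows "z \<in> W \<theta>"
proof -
  from assms obtain i \<Gamma>s where perm: "permitted x y \<theta> i \<Gamma>s" and z: "focus i = z"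
    by (auto simp: outstanding_def)
  have "lvar (prem i) \<in> W \<theta>" using permittedD(2)[OF perm] by (simp add: W_def)
  with permittedD(1)[OF perm] z show ?thesis by cases auto
qed

text \<open>The classes of \<open>x\<close> and \<open>y\<close> contain no other variable, so two
  variables in one class are both introduced and are separated by their times.\<close>

lemma var_less_total:
  assumes "W \<theta> \<subseteq> {x, y} \<union> introduced \<theta>" "v \<in> W \<theta>" "w \<in> W \<theta>" "v \<noteq> w"
  shows "var_less x y \<theta> v w \<or> var_less x y \<theta> w v"
proof (cases "var_class x y \<theta> v = var_class x y \<theta> w")
  case True
  then have "v \<notin> {x, y}" "w \<notin> {x, y}"
    using assms(4) by (auto simp: var_class_def split: if_splits)
  moreover from this have "intro_time \<theta> v \<noteq> intro_time \<theta> w"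
    using assms intro_time_inj by blast
  ultimately show ?thesis
    using True unfolding var_less_def by (metis linorder_neqE_nat)
qed (auto simp: var_less_def)

text \<open>Needed for progress: without a smallest variable, the loop could get stuck on an
  expandable branch.\<close>

lemma smallest_outstanding_exists:
  assumes "derived x y P \<theta>" and "expandable x y \<theta>"
  shows "\<exists>z. smallest_outstanding x y \<theta> z"
proof -
  \<comment> \<open>A well-founded relation containing \<open>var_less\<close>; a minimal
    outstanding variable for it is the smallest one by totality.\<close>
  let ?r = "inv_image (less_than <*lex*> less_than) (\<lambda>v. (var_class x y \<theta> v, intro_time \<theta> v))"
  from assms(2) obtain z0 where "outstanding x y \<theta> z0"
    by (auto simp: expandable_def outstanding_def)
  moreover have "wf ?r" by (intro wf_inv_image wf_lex_prod wf_less_than)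
  ultimately obtain z where z: "outstanding x y \<theta> z"
    and min: "\<And>v. (v, z) \<in> ?r \<Longrightarrow> \<not> outstanding x y \<theta> v"
    using wfE_min[of ?r z0 "{v. outstanding x y \<theta> v}"] by (metis (no_types) mem_Collect_eq)
  have "var_less x y \<theta> z v" if "outstanding x y \<theta> v" "v \<noteq> z" for v
  proof -
    have "\<not> var_less x y \<theta> v z"
      using min[of v] that(1) by (auto simp: var_less_def)
    then show ?thesis
      using var_less_total[OF derived_W[OF assms(1)]] outstanding_in_W z that by blast
  qed
  with z show ?thesis unfolding smallest_outstanding_def by blast
qed

section \<open>The termination measure\<close>

text \<open>\<open>n\<close> is the remaining depth budget. A leaf of weight \<open>3 ^ n\<close>
  gives way to at most two of weight \<open>3 ^ (n - 1)\<close>, so base 3 makes the sum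
  drop.\<close>

fun weight :: "nat \<Rightarrow> dtree \<Rightarrow> nat" where
  "weight n (Leaf N) = 3 ^ n"
| "weight n (Inner N i ts) = sum_list (map (weight (n - 1)) ts)"

lemma weight_extend:
  "branch_at t p \<theta> \<Longrightarrow> length (hist \<theta>) < n \<Longrightarrow> length \<Gamma>s \<le> 2 \<Longrightarrow>
   weight n (extend t p i \<Gamma>s) < weight n t"
proof (induction arbitrary: n rule: branch_at.induct)
  case (1 N)
  then obtain m where n: "n = Suc m" by (cases n) auto
  have "length \<Gamma>s * 3 ^ m \<le> 2 * (3::nat) ^ m" using 1 by simp
  also have "\<dots> < 3 * 3 ^ m" by simp
  finally show ?case by (simp add: n comp_def map_replicate_const sum_list_replicate)
next
  case (2 k ts p h L N j)
  have less: "weight (n - 1) (extend (ts ! k) p i \<Gamma>s) < weight (n - 1) (ts ! k)"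
    using "2.IH"[of "n - 1"] "2.prems" by simp
  \<comment> \<open>Ensures that the subtraction on naturals in \<open>sum_list_update\<close> is
    not truncated.\<close>
  have "weight (n - 1) (ts ! k) \<le> sum_list (map (weight (n - 1)) ts)"
    using "2.hyps"(1) by (intro member_le_sum_list) auto
  with less "2.hyps"(1) show ?case
    by (simp add: map_update sum_list_update)
qed

fun state_ok :: "ovar \<Rightarrow> ovar \<Rightarrow> rterm \<Rightarrow> pstate \<Rightarrow> bool" where
  "state_ok x y P (Select t) \<longleftrightarrow> (\<forall>q \<theta>. branch_at t q \<theta> \<longrightarrow> derived x y P \<theta>)"
| "state_ok x y P (Loop t p) \<longleftrightarrow>
     (\<forall>q \<theta>. branch_at t q \<theta> \<longrightarrow> derived x y P \<theta>) \<and> (\<exists>\<theta>. branch_at t p \<theta>)"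
| "state_ok x y P (Treat t p z) \<longleftrightarrow>
     (\<forall>q \<theta>. branch_at t q \<theta> \<longrightarrow> derived x y P \<theta>) \<and> (\<exists>\<theta>. branch_at t p \<theta>)"
| "state_ok x y P _ \<longleftrightarrow> True"

fun tree_weight :: "rterm \<Rightarrow> pstate \<Rightarrow> nat" where
  "tree_weight P (Select t) = weight (length_bound P) t"
| "tree_weight P (Loop t p) = weight (length_bound P) t"
| "tree_weight P (Treat t p z) = weight (length_bound P) t"
| "tree_weight P _ = 0"

text \<open>The step entering \<open>Treat\<close> needs an outstanding variable and the one leaving it needs
  the lack of one, so a run visits these ranks in decreasing order until a rule is applied.\<close>

fun rank :: "ovar \<Rightarrow> ovar \<Rightarrow> pstate \<Rightarrow> nat" where
  "rank x y (Treat t p z) =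
     (if \<exists>\<theta>. branch_at t p \<theta> \<and> (axiomatic_branch \<theta> \<or> \<not> outstanding x y \<theta> z) then 5 else 1)"
| "rank x y (Loop t p) = (if \<exists>\<theta>. branch_at t p \<theta> \<and> axiomatic_branch \<theta> then 4 else 2)"
| "rank x y (Select t) = 3"
| "rank x y _ = 0"

text \<open>Ranks are at most 5, so with factor 6 the loss of one unit of weight outweighs any
  increase in rank.\<close>

definition measure_of_state :: "ovar \<Rightarrow> ovar \<Rightarrow> rterm \<Rightarrow> pstate \<Rightarrow> nat" where
  "measure_of_state x y P s = 6 * tree_weight P s + rank x y s"

lemma rank_le: "rank x y s \<le> 5"
  by (cases s) auto

section \<open>Invariant, descent and progress of the procedure\<close>

lemma derived_extend:
  assumes "\<forall>q \<theta>. branch_at t q \<theta> \<longrightarrow> derived x y P \<theta>"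
    and "branch_at t p \<theta>" "permitted x y \<theta> i \<Gamma>s"
    and "branch_at (extend t p i \<Gamma>s) q \<theta>'"
  shows "derived x y P \<theta>'"
  using branch_at_extendD[OF assms(2,4)] assms(1-3) by (auto intro: derived.step)

lemma state_ok_step: "proc_step x y s s' \<Longrightarrow> state_ok x y P s \<Longrightarrow> state_ok x y P s'"
proof (induction rule: proc_step.induct)
  case (expand t p \<theta> i \<Gamma>s z k)
  then show ?case
    using derived_extend[of t x y P p \<theta> i \<Gamma>s] branch_at_extend_child[of t p \<theta> k \<Gamma>s i] by auto
qed auto

text \<open>A rule application lowers the weight. Every other step keeps the tree, or ends in a
  result of weight 0, and lowers the rank.\<close>

lemma measure_step:
  "proc_step x y s s' \<Longrightarrow> state_ok x y P s \<Longrightarrow>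
   measure_of_state x y P s' < measure_of_state x y P s"
proof (induction rule: proc_step.induct)
  case (expand t p \<theta> i \<Gamma>s z k)
  let ?s' = "Treat (extend t p i \<Gamma>s) (p @ [k]) z"
  \<comment> \<open>The length bound is used for the child, which is one longer, to get the strict
    inequality for \<theta>.\<close>
  have "derived x y P (child \<theta> i (\<Gamma>s ! k))"
    using expand by (auto intro: derived.step)
  from derived_length_le[OF this] have "length (hist \<theta>) < length_bound P" by simp
  then have "weight (length_bound P) (extend t p i \<Gamma>s) < weight (length_bound P) t"
    using weight_extend expand.hyps(1) rule_inst_length(2)[OF permittedD(1)[OF expand.hyps(3)]]
    by blast
  then have "tree_weight P ?s' < tree_weight P (Treat t p z)" by simp
  then show ?case
    using rank_le[of x y ?s'] unfolding measure_of_state_def by linarith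
next
  case (select t p \<theta>)
  then show ?case
    by (auto simp: measure_of_state_def dest: branch_at_fun)
next
  case (enter t p \<theta> z)
  then show ?case
    by (auto simp: measure_of_state_def smallest_outstanding_def dest: branch_at_fun)
qed (auto simp: measure_of_state_def)

lemma proc_step_exists:
  assumes "state_ok x y P s" and "\<not> is_result s"
  shows "\<exists>s'. proc_step x y s s'"
proof (cases s)
  case (Select t)
  then show ?thesis
    using proc_step.select proc_step.select_none by (metis closed_tree_def)
next
  case (Loop t p)
  with assms obtain \<theta> where \<theta>: "branch_at t p \<theta>" "derived x y P \<theta>" by auto
  then show ?thesis
    using Loop smallest_outstanding_exists[OF \<theta>(2)] proc_step.enter proc_step.stop_closed
      proc_step.next_branch proc_step.stop_open by metis
next
  case (Treat t p z)
  with assms obtain \<theta> where \<theta>: "branch_at t p \<theta>" by auto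
  show ?thesis
  proof (cases "axiomatic_branch \<theta> \<or> \<not> outstanding x y \<theta> z")
    case True
    then show ?thesis using Treat \<theta> proc_step.leave by blast
  next
    case False
    let ?A = "\<lambda>i. (\<exists>\<Gamma>s. permitted x y \<theta> i \<Gamma>s) \<and> focus i = z"
    from False obtain i0 where "?A i0" by (auto simp: outstanding_def)
    \<comment> \<open>\<open>expand\<close> demands an instance of least phase among those with
      focus \<open>z\<close>.\<close>
    from ex_has_least_nat[of ?A i0 phase, OF this]
    obtain i where i: "?A i" and least: "\<And>j. ?A j \<Longrightarrow> phase i \<le> phase j" by blast
    from i obtain \<Gamma>s where perm: "permitted x y \<theta> i \<Gamma>s" by blast
    \<comment> \<open>Every rule has a conclusion set, so there is a new branch on which to
      continue.\<close>
    then have "0 < length \<Gamma>s"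
      using rule_inst_length(1) permittedD(1) by blast
    then show ?thesis
      using proc_step.expand[OF \<theta> _ perm] False i least Treat by blast
  qed
qed (use assms in auto)

theorem theorem1:
  fixes x y :: ovar and P :: rterm
  assumes "P \<in> RT0"
  shows "always_terminates x y (Select (initial_tree (Fm x P y)))"
proof -
  let ?s = "Select (initial_tree (Fm x P y))"
  have ok: "state_ok x y P ?s"
    by (auto simp: initial_tree_def elim!: branch_at.cases[of "Leaf _"] intro: derived.init)
  have "\<not> (\<forall>n. proc_step x y (run n) (run (Suc n)))" if "run 0 = ?s" for run
  proof
    assume steps: "\<forall>n. proc_step x y (run n) (run (Suc n))"
    have "state_ok x y P (run n)" for n
      using ok that steps by (induction n) (auto intro: state_ok_step)
    \<comment> \<open>An infinite run would be an infinite descent in the natural numbers.\<close>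
    with steps have "\<forall>n. (run (Suc n), run n) \<in> measure (measure_of_state x y P)"
      by (simp add: measure_step)
    then show False using wf_measure unfolding wf_iff_no_infinite_down_chain by blast
  qed
  moreover have "state_ok x y P s'" if "(proc_step x y)\<^sup>*\<^sup>* ?s s'" for s'
    using that by (induction rule: rtranclp_induct) (use ok state_ok_step in auto)
  ultimately show ?thesis
    unfolding always_terminates_def using proc_step_exists by blast
qed

end
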